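(* Let $m\ge 3$ be odd, $i$ a positive integer with $\gcd(i,m)=1$, $q=2^i$, $a\in\mathbb{F}_{2^m}^*$, and \[G_a(x,y,z)=\bigl(x^{q+1}+ax^qz+yz^q,\; x^qz+y^{q+1},\; xy^q+ay^qz+z^{q+1}\bigr)\] as a map $\mathbb{F}_{2^m}^3\to\mathbb{F}_{2^m}^3$. The following are equivalent: (i) $Q_a(T)=T^{q^2+q+1}+aT+1$ has no root in $\mathbb{F}_{2^m}$; (ii) $G_a$ is a permutation of $\mathbb{F}_{2^m}^3$; (iii) $G_a$ is APN on $\mathbb{F}_{2^m}^3$.
   Context: A function $F:\mathbb{F}_{2^m}^n\to\mathbb{F}_{2^m}^n$ is almost perfect nonlinear (APN) if for every nonzero $\mathbf u\in\mathbb{F}_{2^m}^n$ and every $\mathbf b\in\mathbb{F}_{2^m}^n$, the equation $F(\mathbf x+\mathbf u)+F(\mathbf x)=\mathbf b$ has at most two solutions $\mathbf x\in\mathbb{F}_{2^m}^n$. *)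

theory Defs
  imports "HOL-Analysis.Analysis" "HOL-Computational_Algebra.Computational_Algebra"
begin

text \<open>
  In characteristic 2, the case of interest, \<open>F (x + u) + F x\<close> is the derivative of
  \<open>F\<close> in direction \<open>u\<close>. Since the domain is finite, \<open>card\<close> is the actual number of solutions.
\<close>

definition apn :: "('a::finite_field ^ 'n \<Rightarrow> 'a ^ 'n) \<Rightarrow> bool" where
  "apn F \<longleftrightarrow> (\<forall>u b. u \<noteq> 0 \<longrightarrow> card {x. F (x + u) + F x = b} \<le> 2)"

definition Q_poly :: "nat \<Rightarrow> 'a::finite_field \<Rightarrow> 'a poly" where
  "Q_poly q a = monom 1 (q ^ 2 + q + 1) + monom a 1 + 1"

definition G_map :: "nat \<Rightarrow> 'a::finite_field \<Rightarrow> 'a ^ 3 \<Rightarrow> 'a ^ 3" where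
  "G_map q a v =
    (let x = v $ 1; y = v $ 2; z = v $ 3 in
     vector [x ^ (q + 1) + a * x ^ q * z + y * z ^ q,
             x ^ q * z + y ^ (q + 1),
             x * y ^ q + a * y ^ q * z + z ^ (q + 1)])"

end

theory Submission
  imports Defs "HOL-Number_Theory.Residues"
begin

text \<open>
  Up to an invertible linear map, \<open>G v\<close> is the cross product of \<open>v\<close> with \<open>phi v\<close>, where \<open>phi\<close> is
  a bijective \<open>q\<close>-semilinear map. Let \<open>psi\<close> be the semilinear map induced by \<open>phi\<close> on cross
  products. Roots of \<open>Q\<close> correspond to eigenvectors of \<open>psi\<close>, and trace duality shows that \<open>psi\<close>
  has an eigenvector iff \<open>phi\<close> has one. Since \<open>d \<mapsto> d ^ (q - 1)\<close> permutes the nonzero elements,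
  eigenvectors can be scaled to fixed vectors.

  If \<open>phi u = u\<close> with \<open>u \<noteq> 0\<close>, then \<open>G\<close> vanishes on the line spanned by \<open>u\<close>, so it is neither
  injective nor APN. If there are no eigenvectors, then \<open>G (x + u) = G x\<close> and the homogeneous
  equation of the derivative of \<open>G\<close> in direction \<open>u\<close> both force the unknown to be \<open>c *s u\<close> with
  \<open>c ^ q + c\<close> equal to 1 and 0 respectively; the former is impossible and the latter gives
  \<open>c \<in> {0, 1}\<close>.
\<close>

unbundle no Formal_Power_Series.fps_syntax

section \<open>The cross product over a commutative ring\<close>

definition cross :: "'a::comm_ring_1 ^ 3 \<Rightarrow> 'a ^ 3 \<Rightarrow> 'a ^ 3" where
  "cross u v = vector [u $ 2 * v $ 3 - u $ 3 * v $ 2,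
                       u $ 3 * v $ 1 - u $ 1 * v $ 3,
                       u $ 1 * v $ 2 - u $ 2 * v $ 1]"

definition dot :: "'a::comm_ring_1 ^ 3 \<Rightarrow> 'a ^ 3 \<Rightarrow> 'a" where
  "dot u v = u $ 1 * v $ 1 + u $ 2 * v $ 2 + u $ 3 * v $ 3"

lemma cross_self [simp]: "cross u u = 0"
  by (simp add: cross_def vec_eq_iff forall_3 algebra_simps)

lemma cross_zero_right [simp]: "cross u 0 = 0"
  by (simp add: cross_def vec_eq_iff forall_3)

lemma cross_add_left: "cross (u + v) w = cross u w + cross v w"
  and cross_add_right: "cross w (u + v) = cross w u + cross w v"
  and cross_diff_right: "cross w (u - v) = cross w u - cross w v"
  and cross_scale_left: "cross (c *s u) w = c *s cross u w"
  and cross_scale_right: "cross w (c *s u) = c *s cross w u"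
  by (simp_all add: cross_def vec_eq_iff forall_3 algebra_simps)

lemmas cross_linear = cross_add_left cross_add_right cross_diff_right
  cross_scale_left cross_scale_right

lemma cross_commute: "cross u v = - cross v u"
  by (simp add: cross_def vec_eq_iff forall_3 algebra_simps)

lemma dot_cross_left [simp]: "dot u (cross u v) = 0"
  and dot_cross_right [simp]: "dot v (cross u v) = 0"
  by (simp_all add: cross_def dot_def algebra_simps)

lemma dot_add_right: "dot u (v + w) = dot u v + dot u w"
  and dot_scale_right: "dot u (c *s v) = c * dot u v"
  by (simp_all add: dot_def algebra_simps)

lemma cross_cross: "cross (cross u p) w = dot u w *s p - dot p w *s u"
  by (simp add: cross_def dot_def vec_eq_iff forall_3 algebra_simps)

text \<open>The factor is read off at a coordinate where \<open>u\<close> does not vanish.\<close>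

lemma cross_eq_0_imp_scale:
  fixes u w :: "'a::field ^ 3"
  assumes "cross u w = 0" and "u \<noteq> 0"
  obtains c where "w = c *s u"
proof -
  have e: "u $ 2 * w $ 3 = u $ 3 * w $ 2" "u $ 3 * w $ 1 = u $ 1 * w $ 3"
    "u $ 1 * w $ 2 = u $ 2 * w $ 1"
    using assms(1) by (simp_all add: cross_def vec_eq_iff forall_3)
  consider "u $ 1 \<noteq> 0" | "u $ 2 \<noteq> 0" | "u $ 3 \<noteq> 0"
    using assms(2) by (auto simp: vec_eq_iff forall_3)
  then show thesis
  proof cases
    case 1
    show thesis by (rule that[of "w $ 1 / u $ 1"])
        (use 1 e in \<open>simp add: vec_eq_iff forall_3 field_simps\<close>)
  next
    case 2
    show thesis by (rule that[of "w $ 2 / u $ 2"])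
        (use 2 e in \<open>simp add: vec_eq_iff forall_3 field_simps\<close>)
  next
    case 3
    show thesis by (rule that[of "w $ 3 / u $ 3"])
        (use 3 e in \<open>simp add: vec_eq_iff forall_3 field_simps\<close>)
  qed
qed

section \<open>Finite fields of odd degree over the two-element field\<close>

locale odd_binary_field =
  fixes m i q :: nat and a :: "'a::finite_field"
  assumes card: "CARD('a) = 2 ^ m"
    and odd_m: "odd m" and i_pos: "i > 0" and gcd_1: "gcd i m = 1"
    and q_def: "q = 2 ^ i"
begin

lemma CHAR_2: "CHAR('a) = 2"
proof -
  have "CHAR('a) dvd 2 ^ m" using CHAR_dvd_CARD[where 'a='a] card by simp
  with CHAR_prime[where 'a='a] have "CHAR('a) dvd 2" by (rule prime_dvd_power)
  then show ?thesis using CHAR_prime[where 'a='a] two_is_prime_nat primes_dvd_imp_eq by blast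
qed

lemma uminus_eq [simp]: "- x = (x :: 'a)"
  by (rule uminus_CHAR_2[OF CHAR_2])

lemma minus_eq [simp]: "x - y = (x + y :: 'a)"
  by (rule minus_CHAR_2[OF CHAR_2])

lemma two_eq_0 [simp]: "(2 :: 'a) = 0"
  using of_nat_CHAR[where 'a='a] CHAR_2 by simp

lemma add_self [simp]: "x + x = (0 :: 'a)"
  using minus_eq[of x x] by simp

lemma add_self_left [simp]: "x + (x + y) = (y :: 'a)"
  by (simp flip: add.assoc)

lemma add_eq_0_iff_eq [simp]: "x + y = 0 \<longleftrightarrow> x = (y :: 'a)"
  by (metis minus_eq eq_iff_diff_eq_0)

lemma q_pos: "q > 0" by (simp add: q_def)

lemma pow_q_add: "(x + y :: 'a) ^ q = x ^ q + y ^ q"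
  by (rule freshmans_dream'[where n=i]) (use CHAR_2 q_def in simp_all)

text \<open>The element \<open>c\<close> is fixed by the \<open>k\<close>-th power of Frobenius and,
  as in any field with \<open>2 ^ m\<close> elements, by the \<open>m\<close>-th. A Bezout identity
  makes it fixed by Frobenius itself, so \<open>c ^ 2 = c\<close>.\<close>

lemma fixed_by_coprime_frobenius:
  fixes c :: 'a
  assumes "c ^ (2 ^ k) = c" "k > 0" "gcd k m = 1"
  shows "c = 0 \<or> c = 1"
proof -
  have iter: "x ^ ((2 ^ n) ^ l) = x" if "x ^ (2 ^ n) = x" for x :: 'a and n l :: nat
    using that by (induction l) (simp_all add: power_mult)
  obtain s r where "k * s = m * r + 1"
    using bezout_nat[of k m] assms by auto
  then have "c ^ (2 ^ (k * s)) = (c ^ (2 ^ (m * r))) ^ 2"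
    by (simp only: power_add power_mult power_one_right)
  moreover have "c ^ (2 ^ (k * s)) = c"
    using iter[OF assms(1), of s] by (simp add: power_mult)
  moreover have "c ^ (2 ^ (m * r)) = c"
    using iter[of c m r] finite_field_power_card_eq_same[of c] card by (simp add: power_mult)
  ultimately have "c * c = c * 1" by (simp add: power2_eq_square)
  then show ?thesis by (metis mult_cancel_left)
qed

lemma pow_q_eq_self: "(c :: 'a) ^ q = c \<Longrightarrow> c = 0 \<or> c = 1"
  using fixed_by_coprime_frobenius[of c i] i_pos gcd_1 q_def by simp

text \<open>A solution would be fixed by the \<open>2i\<close>-th power of Frobenius, and \<open>2i\<close> is coprime to \<open>m\<close>.\<close>
lemma pow_q_add_self_neq_1: "(c :: 'a) ^ q + c \<noteq> 1"
proof
  assume "c ^ q + c = 1"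
  then have c: "c ^ q = c + 1" by (metis add.commute add_self_left)
  have "c ^ (2 ^ (2 * i)) = (c ^ q) ^ q"
    by (simp add: q_def flip: power_mult power_add mult_2)
  also have "\<dots> = c" by (simp add: c pow_q_add)
  finally have "c ^ (2 ^ (2 * i)) = c" .
  moreover have "gcd (2 * i) m = 1"
    using gcd_1 odd_m by (simp add: coprime_mult_left_iff flip: coprime_iff_gcd_eq_1
        del: One_nat_def)
  ultimately have "c = 0 \<or> c = 1"
    using fixed_by_coprime_frobenius[of c "2 * i"] i_pos by simp
  then show False using c q_pos by (auto simp: power_0_left)
qed

text \<open>If \<open>d ^ q / d\<close> takes the same value at two nonzero points, their ratio is
  fixed by the \<open>q\<close>-th power, hence is 1. Since 0 is sent to 0, the map is injective on
  the whole finite field, and so surjective.\<close>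

lemma ex_pow_q_eq_mult: "\<exists>c. c \<noteq> 0 \<and> c ^ q = l * c" if "l \<noteq> 0" for l :: 'a
proof -
  have "inj (\<lambda>d::'a. d ^ q / d)"
  proof (rule injI)
    fix x y :: 'a
    assume h: "x ^ q / x = y ^ q / y"
    show "x = y"
    proof (cases "x = 0 \<or> y = 0")
      case True
      then show ?thesis using h by auto
    next
      case False
      then have "(x / y) ^ q = x / y" using h by (simp add: power_divide field_simps)
      then show ?thesis using pow_q_eq_self[of "x / y"] False by auto
    qed
  qed
  then have "surj (\<lambda>d::'a. d ^ q / d)" by (rule finite_UNIV_inj_surj[OF finite])
  then obtain c where "l = c ^ q / c" by (rule surjE)
  then show ?thesis using that by (intro exI[of _ c]) auto
qed

section \<open>The absolute trace to the two-element field\<close>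

definition trace :: "'a \<Rightarrow> 'a" where
  "trace x = (\<Sum>j<m. x ^ (2 ^ j))"

lemma trace_add: "trace (x + y) = trace x + trace y"
  unfolding trace_def sum.distrib[symmetric]
  by (intro sum.cong refl freshmans_dream') (use CHAR_2 in simp_all)

lemma trace_square: "trace (x ^ 2) = trace x"
proof -
  \<comment> \<open>The sum has one extra term: splitting off \<open>j = 0\<close> leaves the trace
    of the square, while splitting off \<open>j = m\<close> leaves the trace of \<open>x\<close>.
    Both split-off terms equal \<open>x\<close>.\<close>
  have "trace (x ^ 2) + x = (\<Sum>j<Suc m. x ^ (2 ^ j))"
    unfolding trace_def by (subst sum.lessThan_Suc_shift) (simp flip: power_mult)
  also have "\<dots> = trace x + x"
    using finite_field_power_card_eq_same[of x] card by (simp add: trace_def)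
  finally show ?thesis by simp
qed

lemma trace_pow_q: "trace (x ^ q) = trace x"
proof -
  have "trace (x ^ (2 ^ k)) = trace x" for k
    by (induction k) (simp_all add: power_mult trace_square mult.commute[of 2])
  then show ?thesis by (simp add: q_def)
qed

lemma trace_1: "trace 1 = 1"
  using odd_m two_eq_0 by (auto simp: trace_def elim!: oddE)

lemma trace_nondegenerate: "x = 0" if "\<And>z. trace (x * z) = 0"
  using that[of "inverse x"] trace_1 by (cases "x = 0") auto

section \<open>Two trace-dual linearized polynomials\<close>

text \<open>Zeros of \<open>lin\<close> are the first coordinates of fixed vectors of
  \<open>phi\<close>; zeros of \<open>lin_adj\<close> are the third coordinates of fixed vectors of
  \<open>psi\<close>.\<close>

definition lin :: "'a \<Rightarrow> 'a" where
  "lin x = ((x ^ q) ^ q) ^ q + a * (x ^ q) ^ q + x"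

definition lin_adj :: "'a \<Rightarrow> 'a" where
  "lin_adj w = ((w ^ q) ^ q) ^ q + a * w ^ q + w"

lemma pow_q_eq_0 [simp]: "(x :: 'a) ^ q = 0 \<longleftrightarrow> x = 0"
  using q_pos by simp

lemma pow_q_0 [simp]: "(0 :: 'a) ^ q = 0"
  by (simp add: q_pos)

text \<open>The trace is invariant under \<open>q\<close>-th powers, so these can be shifted from
  one factor to the other: the two maps are adjoint up to Frobenius twists.\<close>

lemma trace_lin: "trace (lin_adj w * (x ^ q) ^ q) = trace (w ^ q * lin x)"
proof -
  define X where "X = (x ^ q) ^ q"
  have "trace (lin_adj w * X)
      = trace (((w ^ q) ^ q) ^ q * X) + trace (a * w ^ q * X) + trace (w * X)"
    by (simp add: lin_adj_def algebra_simps flip: trace_add)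
  also have "trace (((w ^ q) ^ q) ^ q * X) = trace (w ^ q * x)"
    using trace_pow_q[of "w ^ q * x"] trace_pow_q[of "(w ^ q) ^ q * x ^ q"]
    by (simp add: X_def power_mult_distrib)
  also have "trace (w * X) = trace (w ^ q * X ^ q)"
    using trace_pow_q[of "w * X"] by (simp add: power_mult_distrib)
  also have "trace (w ^ q * x) + trace (a * w ^ q * X) + trace (w ^ q * X ^ q)
      = trace (w ^ q * lin x)"
    by (simp add: lin_def X_def algebra_simps flip: trace_add)
  finally show ?thesis by (simp add: X_def)
qed

lemma lin_add: "lin (x + y) = lin x + lin y"
  and lin_adj_add: "lin_adj (x + y) = lin_adj x + lin_adj y"
  by (simp_all add: lin_def lin_adj_def pow_q_add algebra_simps)

lemma surj_if_additive_kernel_0: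
  fixes f :: "'a \<Rightarrow> 'a"
  assumes "\<And>x y. f (x + y) = f x + f y" "\<And>x. f x = 0 \<Longrightarrow> x = 0"
  shows "surj f"
proof (rule finite_UNIV_inj_surj[OF finite], rule injI)
  fix x y assume "f x = f y"
  then have "f (x + y) = 0" by (simp add: assms(1))
  then have "x + y = 0" by (rule assms(2))
  then show "x = y" by simp
qed

text \<open>If one kernel were trivial, that map would be onto by finiteness. By
  \<open>trace_lin\<close>, a Frobenius power of a nonzero kernel element of the other map would
  then be trace-orthogonal to the whole field.\<close>

lemma lin_kernel_iff: "(\<exists>x. x \<noteq> 0 \<and> lin x = 0) \<longleftrightarrow> (\<exists>w. w \<noteq> 0 \<and> lin_adj w = 0)"
proof (rule iffI; rule ccontr)
  assume h: "\<exists>x. x \<noteq> 0 \<and> lin x = 0" and n: "\<nexists>w. w \<noteq> 0 \<and> lin_adj w = 0"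
  then obtain x where x: "x \<noteq> 0" "lin x = 0" by blast
  have s: "surj lin_adj" by (rule surj_if_additive_kernel_0) (use n lin_adj_add in auto)
  have "(x ^ q) ^ q = 0"
  proof (rule trace_nondegenerate)
    fix z
    obtain w where "z = lin_adj w" using s by (metis surjD)
    then show "trace ((x ^ q) ^ q * z) = 0"
      using trace_lin[of w x] x by (simp add: mult.commute trace_def power_0_left)
  qed
  then show False using x by simp
next
  assume h: "\<exists>w. w \<noteq> 0 \<and> lin_adj w = 0" and n: "\<nexists>x. x \<noteq> 0 \<and> lin x = 0"
  then obtain w where w: "w \<noteq> 0" "lin_adj w = 0" by blast
  have s: "surj lin" by (rule surj_if_additive_kernel_0) (use n lin_add in auto)
  have "w ^ q = 0"
  proof (rule trace_nondegenerate)
    fix z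
    obtain x where "z = lin x" using s by (metis surjD)
    then show "trace (w ^ q * z) = 0"
      using trace_lin[of w x] w by (simp add: trace_def power_0_left)
  qed
  then show False using w by simp
qed

lemma poly_Q: "poly (Q_poly q a) t = (t ^ q) ^ q * t ^ q * t + a * t + 1"
  by (simp add: Q_poly_def poly_monom power_add power2_eq_square power_mult)

text \<open>The substitution is \<open>t = w ^ q / w\<close>.\<close>
lemma Q_root_iff: "(\<exists>t. poly (Q_poly q a) t = 0) \<longleftrightarrow> (\<exists>w. w \<noteq> 0 \<and> lin_adj w = 0)"
proof
  assume "\<exists>t. poly (Q_poly q a) t = 0"
  then obtain t where t: "poly (Q_poly q a) t = 0" by blast
  then have "t \<noteq> 0" by (auto simp: poly_Q)
  then obtain w where w: "w \<noteq> 0" "w ^ q = t * w" using ex_pow_q_eq_mult by blast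
  have "lin_adj w = w * poly (Q_poly q a) t"
    by (simp add: lin_adj_def poly_Q w(2) power_mult_distrib algebra_simps)
  then show "\<exists>w. w \<noteq> 0 \<and> lin_adj w = 0" using w t by auto
next
  assume "\<exists>w. w \<noteq> 0 \<and> lin_adj w = 0"
  then obtain w where w: "w \<noteq> 0" "lin_adj w = 0" by blast
  define t where "t = w ^ q / w"
  have wq: "w ^ q = t * w" using w by (simp add: t_def)
  have "lin_adj w = w * poly (Q_poly q a) t"
    by (simp add: lin_adj_def poly_Q wq power_mult_distrib algebra_simps)
  then show "\<exists>t. poly (Q_poly q a) t = 0" using w by auto
qed

section \<open>The semilinear maps behind \<open>G\<close>\<close>

definition phi :: "'a ^ 3 \<Rightarrow> 'a ^ 3" where
  "phi v = vector [(v $ 3) ^ q + a * (v $ 2) ^ q, (v $ 1) ^ q, (v $ 2) ^ q]"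

definition psi :: "'a ^ 3 \<Rightarrow> 'a ^ 3" where
  "psi n = vector [(n $ 3) ^ q, (n $ 1) ^ q, (n $ 2) ^ q + a * (n $ 3) ^ q]"

lemma vec_uminus_eq [simp]: "- v = (v :: 'a ^ 3)"
  and vec_minus_eq [simp]: "u - v = (u + v :: 'a ^ 3)"
  and vec_add_self [simp]: "v + v = (0 :: 'a ^ 3)"
  by (simp_all add: vec_eq_iff)

lemma vec_add_eq_0_iff_eq [simp]: "u + v = 0 \<longleftrightarrow> u = (v :: 'a ^ 3)"
  by (simp add: vec_eq_iff)

lemma vec_two_mult [simp]: "2 * v = (0 :: 'a ^ 3)"
  by (simp add: mult_2)

lemma vec_add_self_left [simp]: "v + (v + u) = (u :: 'a ^ 3)"
  by (simp flip: add.assoc)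

lemma phi_add: "phi (u + v) = phi u + phi v"
  and phi_scale: "phi (c *s v) = c ^ q *s phi v"
  and psi_scale: "psi (c *s v) = c ^ q *s psi v"
  by (simp_all add: phi_def psi_def vec_eq_iff forall_3 pow_q_add power_mult_distrib algebra_simps)

lemma phi_eq_0: "phi v = 0 \<Longrightarrow> v = 0"
  and psi_eq_0: "psi v = 0 \<Longrightarrow> v = 0"
  by (auto simp: phi_def psi_def vec_eq_iff forall_3)

text \<open>The matrix of \<open>psi\<close> is the cofactor matrix of that of \<open>phi\<close>,
  and taking \<open>q\<close>-th powers coordinatewise commutes with \<open>cross\<close>.\<close>

lemma cross_phi: "cross (phi u) (phi v) = psi (cross u v)"
  by (simp add: phi_def psi_def cross_def vec_eq_iff forall_3 pow_q_add power_mult_distrib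
      algebra_simps)

text \<open>A fixed vector is determined by its first coordinate \<open>x\<close>: the others are
  \<open>x ^ q\<close> and \<open>(x ^ q) ^ q\<close>, and the remaining equation is
  \<open>lin x = 0\<close>.\<close>

lemma ex_phi_fixed_iff: "(\<exists>u. u \<noteq> 0 \<and> phi u = u) \<longleftrightarrow> (\<exists>x. x \<noteq> 0 \<and> lin x = 0)"
proof
  assume "\<exists>u. u \<noteq> 0 \<and> phi u = u"
  then obtain u where u: "u \<noteq> 0" "phi u = u" by blast
  have k: "u $ j = phi u $ j" for j by (simp add: u(2))
  have e: "u $ 1 = (u $ 3) ^ q + a * (u $ 2) ^ q" "u $ 2 = (u $ 1) ^ q" "u $ 3 = (u $ 2) ^ q"
    using k[of 1] k[of 2] k[of 3] unfolding phi_def vector_3 .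
  have "lin (u $ 1) = 0"
    unfolding lin_def add_eq_0_iff_eq by (rule e(1)[unfolded e(3), unfolded e(2), symmetric])
  moreover have "u $ 1 \<noteq> 0"
  proof
    assume "u $ 1 = 0"
    moreover from this have "u $ 2 = 0" by (simp add: e(2))
    moreover from this have "u $ 3 = 0" by (simp add: e(3))
    ultimately show False using u(1) by (simp add: vec_eq_iff forall_3)
  qed
  ultimately show "\<exists>x. x \<noteq> 0 \<and> lin x = 0" by blast
next
  assume "\<exists>x. x \<noteq> 0 \<and> lin x = 0"
  then obtain x where x: "x \<noteq> 0" "lin x = 0" by blast
  define u :: "'a ^ 3" where "u = vector [x, x ^ q, (x ^ q) ^ q]"
  have "((x ^ q) ^ q) ^ q + a * (x ^ q) ^ q = x"
    using x(2) by (simp add: lin_def)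
  then have "phi u = u" by (simp add: phi_def u_def vec_eq_iff forall_3)
  moreover have "u \<noteq> 0" using x(1) by (simp add: u_def vec_eq_iff forall_3)
  ultimately show "\<exists>u. u \<noteq> 0 \<and> phi u = u" by blast
qed

lemma psi_fixed_imp: "\<exists>w. w \<noteq> 0 \<and> lin_adj w = 0" if "n \<noteq> 0" "psi n = n"
proof -
  have k: "n $ j = psi n $ j" for j by (simp add: that(2))
  have e: "n $ 1 = (n $ 3) ^ q" "n $ 2 = (n $ 1) ^ q" "n $ 3 = (n $ 2) ^ q + a * (n $ 3) ^ q"
    using k[of 1] k[of 2] k[of 3] unfolding psi_def vector_3 .
  have "lin_adj (n $ 3) = 0"
    unfolding lin_adj_def add_eq_0_iff_eq by (rule e(3)[unfolded e(2), unfolded e(1), symmetric])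
  moreover have "n $ 3 \<noteq> 0"
  proof
    assume "n $ 3 = 0"
    moreover from this have "n $ 1 = 0" by (simp add: e(1))
    moreover from this have "n $ 2 = 0" by (simp add: e(2))
    ultimately show False using that(1) by (simp add: vec_eq_iff forall_3)
  qed
  ultimately show ?thesis by blast
qed

lemma eigenvector_imp_fixed:
  fixes f :: "'a ^ 3 \<Rightarrow> 'a ^ 3"
  assumes scale: "\<And>c v. f (c *s v) = c ^ q *s f v" and ker: "\<And>v. f v = 0 \<Longrightarrow> v = 0"
    and v: "v \<noteq> 0" "f v = l *s v"
  shows "\<exists>u. u \<noteq> 0 \<and> f u = u"
proof -
  have "l \<noteq> 0" using v ker[of v] by auto
  \<comment> \<open>Semilinearity turns the scalar \<open>c\<close> into \<open>c ^ q\<close>, whose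
    factor \<open>inverse l\<close> cancels the eigenvalue.\<close>
  then obtain c where c: "c \<noteq> 0" "c ^ q = inverse l * c"
    using ex_pow_q_eq_mult[of "inverse l"] by auto
  have "f (c *s v) = c *s v"
    using \<open>l \<noteq> 0\<close> by (simp add: scale v(2) c(2) vec_eq_iff)
  moreover have "c *s v \<noteq> 0" using c v by simp
  ultimately show ?thesis by blast
qed

text \<open>If \<open>v\<close> is not a multiple of \<open>u\<close>, the equation forces \<open>phi (phi u)\<close> into the plane spanned
  by \<open>u\<close> and \<open>phi u\<close>; this plane is then \<open>phi\<close>-invariant and its normal is an eigenvector of
  \<open>psi\<close>.\<close>
lemma polarization_solution:
  assumes no_root: "\<nexists>w. w \<noteq> 0 \<and> lin_adj w = 0"
    and u: "u \<noteq> 0"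
    and eq: "cross v (phi u) + cross u (phi v) = s *s cross u (phi u)"
  obtains c where "v = c *s u" "c ^ q + c = s"
proof -
  define p where "p = phi u"
  define n where "n = cross u p"
  have psi_noeig: False if "k \<noteq> 0" "psi k = l *s k" for k l
    using eigenvector_imp_fixed[of psi k l] psi_scale psi_eq_0 psi_fixed_imp no_root that by metis
  \<comment> \<open>Otherwise \<open>u\<close> is an eigenvector of \<open>phi\<close>, which trace
    duality excludes.\<close>
  have n0: "n \<noteq> 0"
  proof
    assume "n = 0"
    then obtain l where "p = l *s u" using cross_eq_0_imp_scale u unfolding n_def by metis
    then show False
      using eigenvector_imp_fixed[of phi u l] phi_scale phi_eq_0 u no_root
        ex_phi_fixed_iff lin_kernel_iff p_def by metis
  qed
  have p0: "p \<noteq> 0" using n0 by (auto simp: n_def)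
  have vp: "cross v p = s *s n + cross u (phi v)"
    using eq unfolding p_def n_def by (metis add.assoc add.right_neutral vec_add_self)
  \<comment> \<open>Thus \<open>cross v p\<close> is orthogonal to both \<open>u\<close> and
    \<open>p\<close>, and \<open>cross_cross\<close> makes it parallel to \<open>n\<close>.\<close>
  have "dot u (cross v p) = 0"
    by (simp add: vp n_def dot_add_right dot_scale_right)
  then have "cross n (cross v p) = 0"
    by (simp add: n_def cross_cross)
  then obtain c where c: "cross v p = c *s n" using cross_eq_0_imp_scale n0 by metis
  \<comment> \<open>Since \<open>c *s n\<close> is \<open>cross (c *s u) p\<close>, the vector
    \<open>v\<close> lies in the plane of \<open>u\<close> and \<open>p\<close>.\<close>
  have "cross p (v - c *s u) = 0"
    using c cross_commute[of p] by (simp add: n_def cross_linear)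
  then obtain d where d: "v - c *s u = d *s p" using cross_eq_0_imp_scale p0 by metis
  then have v: "v = c *s u + d *s p"
    by (metis add.commute vec_add_self_left vec_minus_eq)
  have "cross u (phi v) = s *s n + c *s n"
    using vp c by (metis add.commute vec_add_self_left)
  then have "cross u (phi v - (s + c) *s p) = 0"
    by (simp add: cross_linear n_def vec.scale_left_distrib del: vec_minus_eq)
  then obtain e where e: "phi v - (s + c) *s p = e *s u" using cross_eq_0_imp_scale u by metis
  have "phi v = c ^ q *s p + d ^ q *s phi p"
    by (simp add: v phi_add phi_scale p_def)
  with e have rel: "d ^ q *s phi p + (c ^ q + c + s) *s p = e *s u"
    by (simp add: vec.scale_left_distrib algebra_simps)
  have "d = 0"
  proof (rule ccontr)
    assume "d \<noteq> 0"
    \<comment> \<open>Crossing with \<open>p = phi u\<close> removes the multiple of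
      \<open>p\<close>, and \<open>cross p (phi p)\<close> is \<open>psi n\<close>.\<close>
    have "d ^ q *s psi n = cross p (d ^ q *s phi p + (c ^ q + c + s) *s p)"
      by (simp add: n_def p_def cross_linear flip: cross_phi)
    also have "\<dots> = e *s n"
      unfolding rel n_def cross_scale_right using cross_commute[of p u] by simp
    finally have "psi n = (e / d ^ q) *s n"
      using \<open>d \<noteq> 0\<close> by (auto simp: vec_eq_iff field_simps)
    then show False using psi_noeig n0 by blast
  qed
  have "(c ^ q + c + s) *s n = cross u (d ^ q *s phi p + (c ^ q + c + s) *s p)"
    using \<open>d = 0\<close> by (simp add: n_def cross_linear)
  also have "\<dots> = 0" unfolding rel cross_scale_right by simp
  finally have "c ^ q + c + s = 0" using n0 by (metis vector_mul_eq_0)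
  then have "c ^ q + c = s" by simp
  moreover have "v = c *s u" using v \<open>d = 0\<close> by simp
  ultimately show thesis using that by blast
qed

section \<open>The map \<open>G\<close> as a sheared cross product, and the equivalences\<close>

definition shear :: "'a ^ 3 \<Rightarrow> 'a ^ 3" where
  "shear v = vector [v $ 3 + a * v $ 1, v $ 1, v $ 2]"

lemma shear_add: "shear (u + v) = shear u + shear v"
  by (simp add: shear_def vec_eq_iff forall_3 algebra_simps)

lemma shear_eq_0 [simp]: "shear v = 0 \<longleftrightarrow> v = 0"
  by (auto simp: shear_def vec_eq_iff forall_3)

lemma shear_inj: "shear u = shear v \<longleftrightarrow> u = v"
  by (auto simp: shear_def vec_eq_iff forall_3)

text \<open>Adding \<open>a\<close> times the first coordinate of the cross product to the third
  cancels \<open>a * y ^ (q + 1)\<close> and supplies \<open>a * x ^ q * z\<close>.\<close>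

lemma G_map_eq: "G_map q a v = shear (cross v (phi v))"
  by (simp add: G_map_def shear_def cross_def phi_def Let_def vec_eq_iff forall_3 algebra_simps)

text \<open>Under \<open>shear\<close>, one summand is independent of \<open>x\<close> and the rest
  is additive in \<open>x\<close>, so differences of solutions satisfy a homogeneous
  equation.\<close>

lemma G_map_add:
  "G_map q a (x + v) + G_map q a x = shear (cross v (phi v) + (cross v (phi x) + cross x (phi v)))"
  by (simp add: G_map_eq phi_add cross_linear flip: shear_add) (simp add: algebra_simps)

lemma no_root_imp_bij:
  assumes "\<nexists>w. w \<noteq> 0 \<and> lin_adj w = 0"
  shows "bij (G_map q a)"
proof -
  have "inj (G_map q a)"
  proof (rule injI, rule ccontr)
    fix x y assume h: "G_map q a x = G_map q a y" and "x \<noteq> y"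
    define u where "u = x + y"
    have u: "u \<noteq> 0" "y = x + u" using \<open>x \<noteq> y\<close> unfolding u_def by auto
    have "G_map q a (x + u) + G_map q a x = 0" using h u by simp
    then have "cross u (phi u) + (cross u (phi x) + cross x (phi u)) = 0"
      unfolding G_map_add by simp
    then have "cross x (phi u) + cross u (phi x) = 1 *s cross u (phi u)"
      by (metis add.commute add.right_neutral vec_add_self_left vector_smult_lid)
    then obtain c :: 'a where "c ^ q + c = 1"
      by (rule polarization_solution[OF assms u(1)])
    then show False using pow_q_add_self_neq_1 by blast
  qed
  then show ?thesis by (simp add: bij_def finite_UNIV_inj_surj)
qed

lemma no_root_imp_apn:
  assumes "\<nexists>w. w \<noteq> 0 \<and> lin_adj w = 0"
  shows "apn (G_map q a)"
  unfolding apn_def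
proof (intro allI impI)
  fix u b :: "'a ^ 3" assume u: "u \<noteq> 0"
  let ?S = "{x. G_map q a (x + u) + G_map q a x = b}"
  show "card ?S \<le> 2"
  proof (cases "?S = {}")
    case False
    then obtain y where y: "y \<in> ?S" by blast
    have "?S \<subseteq> {y, y + u}"
    proof
      fix x assume x: "x \<in> ?S"
      define v where "v = x + y"
      have xv: "x = y + v" by (metis v_def add.commute vec_add_self_left)
      have "G_map q a (x + u) + G_map q a x = G_map q a (y + u) + G_map q a y"
        using x y by simp
      then have "cross u (phi x) + cross x (phi u) = cross u (phi y) + cross y (phi u)"
        unfolding G_map_add shear_inj by simp
      then have "cross v (phi u) + cross u (phi v) = 0 *s cross u (phi u)"
        by (simp add: xv phi_add cross_linear algebra_simps)
      then obtain c where "v = c *s u" "c ^ q + c = 0"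
        by (rule polarization_solution[OF assms u])
      then have "c = 0 \<or> c = 1"
        using pow_q_eq_self by simp
      then show "x \<in> {y, y + u}" using xv \<open>v = c *s u\<close> by auto
    qed
    then have "card ?S \<le> card {y, y + u}" by (rule card_mono[rotated]) simp
    also have "\<dots> \<le> 2" by (simp add: card_insert_if)
    finally show ?thesis .
  qed simp
qed

lemma root_imp_not_bij_not_apn:
  assumes "\<exists>w. w \<noteq> 0 \<and> lin_adj w = 0" and m: "m \<ge> 2"
  shows "\<not> bij (G_map q a)" "\<not> apn (G_map q a)"
proof -
  obtain u where u: "u \<noteq> 0" "phi u = u"
    using assms(1) unfolding lin_kernel_iff[symmetric] ex_phi_fixed_iff[symmetric] by blast
  have G0: "G_map q a (d *s u) = 0" for d
    by (simp add: G_map_eq phi_scale u(2) cross_linear)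
  show "\<not> bij (G_map q a)"
    using G0[of 0] G0[of 1] u(1) by (auto simp: bij_def inj_def)
  show "\<not> apn (G_map q a)"
  proof
    assume "apn (G_map q a)"
    then have le: "card {x. G_map q a (x + u) + G_map q a x = 0} \<le> 2"
      using u(1) unfolding apn_def by blast
    \<comment> \<open>The whole line through \<open>u\<close> solves the equation with
      \<open>b = 0\<close>; it has \<open>2 ^ m\<close> points, more than 2.\<close>
    have "G_map q a (d *s u + u) + G_map q a (d *s u) = 0" for d
      using G0[of "d + 1"] G0[of d] by (simp add: vec.scale_left_distrib)
    then have "range (\<lambda>d. d *s u) \<subseteq> {x. G_map q a (x + u) + G_map q a x = 0}" by auto
    then have "card (range (\<lambda>d. d *s u)) \<le> 2" using le card_mono[OF finite] by (meson le_trans)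
    moreover have "inj (\<lambda>d. d *s u)" using u(1) by (auto simp: inj_def)
    ultimately have "2 ^ m \<le> (2 :: nat) ^ 1" using card by (simp add: card_image)
    then have "m \<le> 1" by (rule power_le_imp_le_exp[rotated]) simp
    then show False using m by simp
  qed
qed

end

theorem theorem2p7:
  fixes m i q :: nat
    and a :: "'a::finite_field"
  assumes "CARD('a) = 2 ^ m"
    and "m \<ge> 3" and "odd m"
    and "i > 0" and "gcd i m = 1"
    and "q = 2 ^ i"
    and "a \<noteq> 0"
  shows "((\<nexists>t. poly (Q_poly q a) t = 0) \<longleftrightarrow> bij (G_map q a)) \<and>
         (bij (G_map q a) \<longleftrightarrow> apn (G_map q a))"
proof -
  interpret odd_binary_field m i q a
    by standard (use assms in auto)
  have "m \<ge> 2" using assms by simp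
  then show ?thesis
    unfolding Q_root_iff using no_root_imp_bij no_root_imp_apn root_imp_not_bij_not_apn by metis
qed

end
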